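(* Let $\mathcal{C}\subset(\mathbb{C}^2)^{\otimes n}$ be an $[[n,k,d]]$ stabilizer code with $k\ge1$ and distance $d\ge2$. Then every nonzero codeword $\psi\in\mathcal{C}$ satisfies $E_{\mathrm{FS}}([\psi])>0$ (that is, every codeword is entangled), and furthermore $$E_{\mathrm{FS}}([\psi])\ \ge\ \arccos\sqrt{1-2^{-\lfloor d/2\rfloor}}.$$
   Context: Stabilizer code: $\mathcal{C}$ is the simultaneous $+1$ eigenspace in $(\mathbb{C}^2)^{\otimes n}$ of an abelian subgroup $\mathcal{S}$ of the $n$-qubit Pauli group with $n-k$ independent generators ($-\mathbb{I}\notin\mathcal{S}$), so $\dim\mathcal{C}=2^k$. Its distance $d$ is the minimum weight (number of qubits acted on non-trivially) of a logical operator, i.e. of a Pauli operator that commutes with all elements of $\mathcal{S}$ but does not belong to $\mathcal{S}$ (up to phase). Fubini--Study distance on $\mathbb{CP}^{2^n-1}$: $D_{\mathrm{FS}}([\psi],[\phi])=\arccos\frac{|\langle\psi|\phi\rangle|}{\|\psi\|\,\|\phi\|}\in[0,\pi/2]$. Segre variety: $\Sigma_n\subset\mathbb{CP}^{2^n-1}$ is the image of the Segre embedding $\mathbb{CP}^1\times\cdots\times\mathbb{CP}^1\to\mathbb{CP}^{2^n-1}$ ($n$ factors), i.e. the set of fully separable (product) states $[\phi_1\otimes\cdots\otimes\phi_n]$. Geometric entanglement: $E_{\mathrm{FS}}([\psi])=\min_{[\phi]\in\Sigma_n}D_{\mathrm{FS}}([\psi],[\phi])$. *)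

theory Defs
  imports "HOL-Analysis.Analysis" "HOL-Algebra.Generated_Groups"
begin

text \<open>
  The qubits are indexed by a finite type \<open>'n\<close>, so \<open>n\<close> is \<open>CARD('n)\<close>, one qubit has state space
  \<open>complex^2\<close>, and the \<open>n\<close>-fold tensor power of \<open>complex^2\<close> is \<open>complex^('n \<Rightarrow> 2)\<close>: a coordinate
  \<open>x :: 'n \<Rightarrow> 2\<close> is a computational basis label, where \<open>1 :: 2\<close> stands for the basis vector \<open>|0>\<close>
  and \<open>2 :: 2\<close> for \<open>|1>\<close>.
\<close>

type_synonym 'n qstate = "complex ^ ('n \<Rightarrow> 2)"
type_synonym 'n qop = "complex ^ ('n \<Rightarrow> 2) ^ ('n \<Rightarrow> 2)"

definition tensor_vec :: "('n::finite \<Rightarrow> complex^2) \<Rightarrow> 'n qstate" where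
  "tensor_vec \<phi> = (\<chi> x. \<Prod>i\<in>UNIV. \<phi> i $ x i)"

definition tensor_op :: "('n::finite \<Rightarrow> complex^2^2) \<Rightarrow> 'n qop" where
  "tensor_op A = (\<chi> x y. \<Prod>i\<in>UNIV. A i $ x i $ y i)"

definition scale_op :: "complex \<Rightarrow> complex^'m^'m \<Rightarrow> complex^'m^'m" where
  "scale_op c A = (\<chi> x y. c * A $ x $ y)"


section \<open>Stabilizer codes\<close>

datatype pauli = PI | PX | PY | PZ

fun pauli_mat :: "pauli \<Rightarrow> complex^2^2" where
  "pauli_mat PI = mat 1"
| "pauli_mat PX = vector [vector [0, 1], vector [1, 0]]"
| "pauli_mat PY = vector [vector [0, - \<i>], vector [\<i>, 0]]"
| "pauli_mat PZ = vector [vector [1, 0], vector [0, - 1]]"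

definition phases :: "complex set" where
  "phases = {1, - 1, \<i>, - \<i>}"

definition pauli_op :: "complex \<Rightarrow> ('n::finite \<Rightarrow> pauli) \<Rightarrow> 'n qop" where
  "pauli_op c p = scale_op c (tensor_op (\<lambda>i. pauli_mat (p i)))"

definition pauli_weight :: "('n::finite \<Rightarrow> pauli) \<Rightarrow> nat" where
  "pauli_weight p = card {i. p i \<noteq> PI}"

definition pauli_group :: "('n::finite qop) monoid" where
  "pauli_group = \<lparr>carrier = {pauli_op c p | c p. c \<in> phases}, mult = (**), one = mat 1\<rparr>"

definition stabilizer_group :: "('n::finite qop) set \<Rightarrow> bool" where
  "stabilizer_group S \<longleftrightarrow>
     subgroup S pauli_group \<and> (\<forall>A\<in>S. \<forall>B\<in>S. A ** B = B ** A) \<and> - mat 1 \<notin> S"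

definition independent_generators :: "('n::finite qop) set \<Rightarrow> ('n qop) set \<Rightarrow> bool" where
  "independent_generators G S \<longleftrightarrow>
     finite G \<and> G \<subseteq> carrier pauli_group \<and> generate pauli_group G = S \<and>
     (\<forall>g\<in>G. g \<notin> generate pauli_group (G - {g}))"

definition code_space :: "('n::finite qop) set \<Rightarrow> ('n qstate) set" where
  "code_space S = {\<psi>. \<forall>A\<in>S. A *v \<psi> = \<psi>}"

definition logical_ops :: "('n::finite qop) set \<Rightarrow> ('n qop) set" where
  "logical_ops S =
     {E \<in> carrier pauli_group. (\<forall>A\<in>S. E ** A = A ** E) \<and> (\<forall>c\<in>phases. scale_op c E \<notin> S)}"

text \<open>Only meaningful if there are logical operators, that is, if at least one qubit is encoded.\<close>

definition code_distance :: "('n::finite qop) set \<Rightarrow> nat" where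
  "code_distance S =
     (LEAST w. \<exists>c\<in>phases. \<exists>p. pauli_op c p \<in> logical_ops S \<and> w = pauli_weight p)"

text \<open>
  \<open>S\<close> defines an \<open>[[CARD('n), k, d]]\<close> code.  The equation \<open>card G + k = CARD('n)\<close> says that there
  are \<open>n - k\<close> generators, without truncated subtraction.
\<close>

definition stabilizer_code :: "('n::finite qop) set \<Rightarrow> nat \<Rightarrow> nat \<Rightarrow> bool" where
  "stabilizer_code S k d \<longleftrightarrow>
     stabilizer_group S \<and>
     (\<exists>G. independent_generators G S \<and> card G + k = CARD('n)) \<and>
     code_distance S = d"


section \<open>Complex projective space and the Fubini--Study distance\<close>

definition herm :: "complex^'m \<Rightarrow> complex^'m \<Rightarrow> complex" where
  "herm \<psi> \<phi> = (\<Sum>x\<in>UNIV. cnj (\<psi> $ x) * \<phi> $ x)"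

definition same_ray :: "complex^'m \<Rightarrow> complex^'m \<Rightarrow> bool" where
  "same_ray \<psi> \<phi> \<longleftrightarrow> \<psi> \<noteq> 0 \<and> \<phi> \<noteq> 0 \<and> (\<exists>c. c \<noteq> 0 \<and> \<phi> = c *s \<psi>)"

lemma part_equivp_same_ray: "part_equivp (same_ray :: complex^'m \<Rightarrow> complex^'m \<Rightarrow> bool)"
proof (rule part_equivpI)
  have "same_ray (1 :: complex^'m) 1"
    unfolding same_ray_def by (auto intro!: exI[of _ 1])
  then show "\<exists>x :: complex^'m. same_ray x x" by blast
  show "symp (same_ray :: complex^'m \<Rightarrow> _)"
  proof (rule sympI)
    fix x y :: "complex^'m"
    assume "same_ray x y"
    then obtain c where "x \<noteq> 0" "y \<noteq> 0" "c \<noteq> 0" "y = c *s x"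
      by (auto simp: same_ray_def)
    then have "inverse c \<noteq> 0 \<and> x = inverse c *s y"
      by (simp add: vec_eq_iff)
    with \<open>x \<noteq> 0\<close> \<open>y \<noteq> 0\<close> show "same_ray y x"
      unfolding same_ray_def by blast
  qed
  show "transp (same_ray :: complex^'m \<Rightarrow> _)"
  proof (rule transpI)
    fix x y z :: "complex^'m"
    assume "same_ray x y" "same_ray y z"
    then obtain c e where "x \<noteq> 0" "z \<noteq> 0" "c \<noteq> 0" "e \<noteq> 0" "y = c *s x" "z = e *s y"
      by (auto simp: same_ray_def)
    then have "x \<noteq> 0" "z \<noteq> 0" "e * c \<noteq> 0 \<and> z = (e * c) *s x"
      by (simp_all add: vec_eq_iff mult.assoc)
    then show "same_ray x z"
      unfolding same_ray_def by blast
  qed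
qed

text \<open>\<open>'m cproj\<close> is the complex projective space of dimension \<open>CARD('m) - 1\<close>, the set of lines of
  \<open>complex^'m\<close>, and \<open>proj_class \<psi>\<close> is the point \<open>[\<psi>]\<close> for \<open>\<psi> \<noteq> 0\<close>.\<close>

quotient_type 'm cproj = "complex^'m" / partial: same_ray
  morphisms rep_class proj_class
  by (rule part_equivp_same_ray)

lemma norm_vector_scalar:
  fixes c :: complex and v :: "complex^'m"
  shows "norm (c *s v) = cmod c * norm v"
  by (simp add: norm_vec_def norm_mult L2_set_right_distrib)

lift_definition fs_dist :: "'m::finite cproj \<Rightarrow> 'm cproj \<Rightarrow> real"
  is "\<lambda>\<psi> \<phi>. arccos (cmod (herm \<psi> \<phi>) / (norm \<psi> * norm \<phi>))"
proof -
  fix \<psi> \<psi>' \<phi> \<phi>' :: "complex^'m"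
  assume "same_ray \<psi> \<psi>'" "same_ray \<phi> \<phi>'"
  then obtain a b where ab: "a \<noteq> 0" "\<psi>' = a *s \<psi>" "b \<noteq> 0" "\<phi>' = b *s \<phi>"
    by (auto simp: same_ray_def)
  have "herm \<psi>' \<phi>' = cnj a * b * herm \<psi> \<phi>"
    by (simp add: herm_def ab sum_distrib_left algebra_simps)
  then show "arccos (cmod (herm \<psi> \<phi>) / (norm \<psi> * norm \<phi>)) =
      arccos (cmod (herm \<psi>' \<phi>') / (norm \<psi>' * norm \<phi>'))"
    using ab by (simp add: norm_vector_scalar norm_mult)
qed


section \<open>Segre variety and geometric entanglement\<close>

lemma tensor_vec_nonzero:
  assumes "\<And>i. \<phi> i \<noteq> 0"
  shows "tensor_vec \<phi> \<noteq> 0"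
proof -
  have "\<forall>i. \<exists>j. \<phi> i $ j \<noteq> 0"
    using assms by (auto simp: vec_eq_iff)
  then obtain x where "\<And>i. \<phi> i $ x i \<noteq> 0" by metis
  then have "tensor_vec \<phi> $ x \<noteq> 0"
    by (simp add: tensor_vec_def)
  then show ?thesis by auto
qed

lift_definition segre :: "('n::finite \<Rightarrow> 2 cproj) \<Rightarrow> ('n \<Rightarrow> 2) cproj" is tensor_vec
proof -
  fix \<phi> \<phi>' :: "'n \<Rightarrow> complex^2"
  assume "\<And>i. same_ray (\<phi> i) (\<phi>' i)"
  then have nz: "\<And>i. \<phi> i \<noteq> 0" "\<And>i. \<phi>' i \<noteq> 0" and "\<forall>i. \<exists>c. c \<noteq> 0 \<and> \<phi>' i = c *s \<phi> i"
    by (auto simp: same_ray_def)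
  then obtain c where c: "\<And>i. c i \<noteq> 0" "\<And>i. \<phi>' i = c i *s \<phi> i"
    by metis
  have "tensor_vec \<phi>' = (\<Prod>i\<in>UNIV. c i) *s tensor_vec \<phi>"
    by (simp add: vec_eq_iff tensor_vec_def c prod.distrib)
  moreover have "(\<Prod>i\<in>UNIV. c i) \<noteq> 0"
    by (simp add: c)
  ultimately show "same_ray (tensor_vec \<phi>) (tensor_vec \<phi>')"
    using nz tensor_vec_nonzero unfolding same_ray_def by blast
qed

definition segre_variety :: "(('n::finite \<Rightarrow> 2) cproj) set" where
  "segre_variety = range segre"

definition geometric_entanglement :: "('n::finite \<Rightarrow> 2) cproj \<Rightarrow> real" where
  "geometric_entanglement \<Psi> = (INF \<Phi>\<in>segre_variety. fs_dist \<Psi> \<Phi>)"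

text \<open>By compactness of the Segre variety the infimum is a minimum.\<close>

lemma geometric_entanglement_attained:
  fixes \<Psi> :: "('n::finite \<Rightarrow> 2) cproj"
  shows "\<exists>\<Phi>\<in>segre_variety. geometric_entanglement \<Psi> = fs_dist \<Psi> \<Phi> \<and>
           (\<forall>\<Phi>'\<in>segre_variety. fs_dist \<Psi> \<Phi> \<le> fs_dist \<Psi> \<Phi>')"
proof -
  have surj: "\<exists>v. v \<noteq> 0 \<and> P = proj_class v" for P :: "'m::finite cproj"
    using Quotient_abs_rep[OF Quotient_cproj, of P] Quotient_rep_reflp[OF Quotient_cproj, of P]
    unfolding same_ray_def by metis
  obtain \<psi> where \<psi>: "\<psi> \<noteq> 0" "\<Psi> = proj_class \<psi>" using surj by blast
  define K where "K = {\<phi> :: (complex^2)^'n. \<forall>i. norm (\<phi> $ i) = 1}"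
  define T where "T \<phi> = tensor_vec (\<lambda>i. \<phi> $ i)" for \<phi> :: "(complex^2)^'n"
  define q where "q \<phi> = cmod (herm \<psi> (T \<phi>)) / (norm \<psi> * norm (T \<phi>))" for \<phi>
  have "K \<subseteq> cball 0 (real CARD('n))"
  proof
    fix \<phi> assume "\<phi> \<in> K"
    then have "norm \<phi> \<le> (\<Sum>i\<in>(UNIV::'n set). 1)"
      unfolding norm_vec_def[of \<phi>] by (intro order.trans[OF L2_set_le_sum]) (auto simp: K_def)
    then show "\<phi> \<in> cball 0 (real CARD('n))" by simp
  qed
  then have "bounded K" using bounded_cball bounded_subset by blast
  moreover have "closed K"
    unfolding K_def by (intro closed_Collect_all closed_Collect_eq continuous_intros)
  ultimately have "compact K" by (simp add: compact_eq_bounded_closed)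
  have contT: "continuous_on K T"
    unfolding T_def tensor_vec_def by (intro continuous_intros)
  have K0: "\<phi> $ i \<noteq> 0" if "\<phi> \<in> K" for \<phi> i
  proof -
    have "norm (\<phi> $ i) = 1" using that by (simp add: K_def)
    then show ?thesis by auto
  qed
  have T0: "T \<phi> \<noteq> 0" if "\<phi> \<in> K" for \<phi>
    unfolding T_def using that by (intro tensor_vec_nonzero K0)
  have "continuous_on K q"
    unfolding q_def herm_def using \<psi> T0 by (intro continuous_intros contT) auto
  moreover have q1: "q \<phi> \<le> 1" "0 \<le> q \<phi>" for \<phi>
  proof -
    have "cmod (herm \<psi> (T \<phi>)) \<le> (\<Sum>x\<in>UNIV. \<bar>norm (\<psi> $ x)\<bar> * \<bar>norm (T \<phi> $ x)\<bar>)"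
      unfolding herm_def by (rule order.trans[OF norm_sum]) (simp add: norm_mult)
    also have "\<dots> \<le> norm \<psi> * norm (T \<phi>)"
      unfolding norm_vec_def by (rule L2_set_mult_ineq)
    finally show "q \<phi> \<le> 1" 
      by (auto simp: q_def divide_le_eq_1 less_le)
  qed (simp add: q_def)
  ultimately have "continuous_on K (\<lambda>\<phi>. arccos (q \<phi>))"
    by (intro continuous_on_arccos) (auto intro: order.trans[of _ 0])
  moreover have "(\<chi> i. axis 1 1) \<in> K"
    by (simp add: K_def)
  ultimately obtain \<phi> where \<phi>: "\<phi> \<in> K" "\<And>\<phi>'. \<phi>' \<in> K \<Longrightarrow> arccos (q \<phi>) \<le> arccos (q \<phi>')"
    using continuous_attains_inf[OF \<open>compact K\<close>, of "\<lambda>\<phi>. arccos (q \<phi>)"] by blast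
  have segre_K: "\<exists>\<phi>'\<in>K. \<Phi> = proj_class (T \<phi>')" if \<Phi>: "\<Phi> \<in> segre_variety" for \<Phi>
  proof -
    obtain P where P: "\<Phi> = segre P" using \<Phi> by (auto simp: segre_variety_def)
    have "\<exists>v. norm v = 1 \<and> P i = proj_class v" for i
    proof -
      obtain v where v: "v \<noteq> 0" "P i = proj_class v" using surj by blast
      define c where "c = complex_of_real (inverse (norm v))"
      have c: "c \<noteq> 0" "norm (c *s v) = 1"
        using v by (simp_all add: c_def norm_vector_scalar norm_inverse)
      have "c *s v \<noteq> 0" using c by (metis norm_zero zero_neq_one)
      then have "same_ray v (c *s v)" using c v unfolding same_ray_def by blast
      then have "proj_class v = proj_class (c *s v)" by (rule Quotient_rel_abs[OF Quotient_cproj])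
      then show ?thesis using c v by metis
    qed
    then obtain f where f: "\<And>i. norm (f i) = 1" "\<And>i. P i = proj_class (f i)" by metis
    have "P = (\<lambda>i. proj_class (f i))" using f by auto
    moreover have "same_ray (f i) (f i)" for i
      using f(1)[of i] by (auto simp: same_ray_def intro!: exI[of _ 1])
    ultimately have "\<Phi> = proj_class (tensor_vec f)"
      using segre.abs_eq[of f] P by (simp add: eq_onp_def rel_fun_def comp_def map_fun_def)
    then show ?thesis using f by (intro bexI[of _ "\<chi> i. f i"]) (simp_all add: T_def K_def)
  qed
  have K_segre: "proj_class (T \<phi>') \<in> segre_variety" if "\<phi>' \<in> K" for \<phi>'
  proof -
    have "same_ray (\<phi>' $ i) (\<phi>' $ i)" for i
      using K0[OF that] by (auto simp: same_ray_def intro!: exI[of _ 1])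
    then have "proj_class (T \<phi>') = segre (\<lambda>i. proj_class (\<phi>' $ i))"
      using segre.abs_eq[of "\<lambda>i. \<phi>' $ i"] by (simp add: T_def rel_fun_def comp_def map_fun_def)
    then show ?thesis by (simp add: segre_variety_def)
  qed
  have dist: "fs_dist \<Psi> (proj_class (T \<phi>')) = arccos (q \<phi>')" if "\<phi>' \<in> K" for \<phi>'
  proof -
    have "same_ray \<psi> \<psi>" "same_ray (T \<phi>') (T \<phi>')"
      using \<psi> T0[OF that] by (auto simp: same_ray_def intro!: exI[of _ 1])
    then show ?thesis using \<psi> by (simp add: fs_dist.abs_eq q_def)
  qed
  define \<Phi> where "\<Phi> = proj_class (T \<phi>)"
  have \<Phi>: "\<Phi> \<in> segre_variety" using K_segre \<phi> by (simp add: \<Phi>_def)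
  have le: "fs_dist \<Psi> \<Phi> \<le> fs_dist \<Psi> \<Phi>'" if "\<Phi>' \<in> segre_variety" for \<Phi>'
    using segre_K[OF that] \<phi> by (auto simp: \<Phi>_def dist)
  have "geometric_entanglement \<Psi> = fs_dist \<Psi> \<Phi>"
    unfolding geometric_entanglement_def using \<Phi> le by (intro cInf_eq_minimum) auto
  with \<Phi> le show ?thesis by blast
qed

end

theory Submission
  imports Defs
begin

text \<open>
  Since \<open>d \<ge> 2\<close>, the claimed bound is at most \<open>arccos (sqrt (1 / 2))\<close>, so it suffices that a
  codeword and a product state have squared overlap at most \<open>1 / 2\<close>.  Some qubit \<open>i\<close> carries no
  stabilizer of weight one: otherwise products of such stabilizers would give \<open>2 ^ n\<close> elements of
  a group with \<open>n - k < n\<close> generators of order two.  As \<open>d \<ge> 2\<close>, each of \<open>X\<^sub>i\<close>, \<open>Y\<^sub>i\<close>, \<open>Z\<^sub>i\<close> then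
  anticommutes with a stabilizer, hence has expectation \<open>0\<close> in every codeword.  So qubit \<open>i\<close> is
  maximally mixed, and already projecting it onto the \<open>i\<close>-th factor of the product state leaves
  only half of the squared norm.
\<close>

section \<open>Tensor products of operators\<close>

text \<open>Expanding the product picks one summand per index, and such a choice is a basis label.
  This is why tensor products of operators multiply, and act on product vectors, factor by
  factor.\<close>

lemma prod_sum_UNIV:
  fixes f :: "'n::finite \<Rightarrow> 'b::finite \<Rightarrow> 'c::comm_semiring_1"
  shows "(\<Prod>i\<in>UNIV. \<Sum>b\<in>UNIV. f i b) = (\<Sum>y\<in>UNIV. \<Prod>i\<in>UNIV. f i (y i))"
  by (simp add: prod_sum_PiE PiE_UNIV_domain)

lemma tensor_op_mult:
  "tensor_op A ** tensor_op B = tensor_op (\<lambda>i. A i ** B i)"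
  by (simp add: tensor_op_def matrix_matrix_mult_def vec_eq_iff prod_sum_UNIV prod.distrib)

lemma tensor_op_tensor_vec:
  "tensor_op A *v tensor_vec \<phi> = tensor_vec (\<lambda>i. A i *v \<phi> i)"
  by (simp add: tensor_op_def tensor_vec_def matrix_vector_mult_def vec_eq_iff prod_sum_UNIV
      prod.distrib)

lemma tensor_op_scale:
  "tensor_op (\<lambda>i. scale_op (s i) (A i)) = scale_op (\<Prod>i\<in>UNIV. s i) (tensor_op A)"
  by (simp add: tensor_op_def scale_op_def vec_eq_iff prod.distrib)

lemma tensor_op_mat_1: "tensor_op (\<lambda>i. mat 1) = (mat 1 :: 'n::finite qop)"
proof -
  have "(\<Prod>i\<in>UNIV. if x i = y i then 1 else 0) = (if x = y then 1 else (0::complex))"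
    for x y :: "'n \<Rightarrow> 2"
  proof (cases "x = y")
    case False
    then obtain i where "x i \<noteq> y i" by blast
    with False show ?thesis by (auto intro!: prod_zero)
  qed simp
  then show ?thesis by (simp add: tensor_op_def mat_def vec_eq_iff)
qed

lemma scale_op_simps [simp]:
  "scale_op 1 A = A" "scale_op (- 1) A = - A" "scale_op c (scale_op e A) = scale_op (c * e) A"
  by (simp_all add: scale_op_def vec_eq_iff)

lemma scale_op_mult:
  "scale_op c A ** B = scale_op c (A ** B)" "A ** scale_op c B = scale_op c (A ** B)"
  by (simp_all add: scale_op_def matrix_matrix_mult_def vec_eq_iff sum_distrib_left algebra_simps)

lemma scale_op_vec: "scale_op c A *v u = c *s (A *v u)"
  by (simp add: scale_op_def matrix_vector_mult_def vec_eq_iff sum_distrib_left algebra_simps)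

text \<open>The matrix \<open>M\<close> on qubit \<open>i\<close>, tensored with identities
  elsewhere. It is allowed to be any matrix, since projections onto a tensor factor are needed
  besides Pauli matrices.\<close>

definition local_op :: "'n::finite \<Rightarrow> complex^2^2 \<Rightarrow> 'n qop" where
  "local_op i M = tensor_op ((\<lambda>_. mat 1)(i := M))"

text \<open>\<open>tensor_op\<close> is only multilinear; splitting off factor \<open>i\<close>
  exhibits the entry as linear in \<open>M\<close>, which gives additivity and scaling.\<close>

lemma local_op_nth:
  "local_op i M $ x $ y = M $ x i $ y i * (\<Prod>j\<in>UNIV - {i}. mat 1 $ x j $ y j)"
  by (simp add: local_op_def tensor_op_def prod.remove[of UNIV i])

lemma local_op_add: "local_op i (M + N) = local_op i M + local_op i N"
  by (simp add: vec_eq_iff local_op_nth algebra_simps)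

lemma local_op_scale: "local_op i (scale_op c M) = scale_op c (local_op i M)"
  by (simp add: vec_eq_iff local_op_nth scale_op_def)

lemma local_op_mat_1: "local_op i (mat 1) = mat 1"
  by (simp add: local_op_def tensor_op_mat_1 fun_upd_idem)

lemma local_op_mult: "local_op i M ** local_op i N = local_op i (M ** N)"
  unfolding local_op_def tensor_op_mult by (rule arg_cong[of _ _ tensor_op]) auto

lemma local_op_tensor_vec:
  assumes "M *v \<phi> i = c *s \<phi> i"
  shows "local_op i M *v tensor_vec \<phi> = c *s tensor_vec \<phi>"
proof -
  have "(\<Prod>j\<in>UNIV. (((\<lambda>_. mat 1)(i := M)) j *v \<phi> j) $ x j) = c * (\<Prod>j\<in>UNIV. \<phi> j $ x j)" for x
    using assms by (simp add: prod.remove[of UNIV i] mult.assoc)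
  then show ?thesis
    by (simp add: local_op_def tensor_op_tensor_vec) (simp add: tensor_vec_def vec_eq_iff)
qed


section \<open>The Hermitian form\<close>

lemma herm_self: "herm u u = of_real ((norm u)\<^sup>2)"
  by (simp add: herm_def norm_vec_def L2_set_def sum_nonneg complex_norm_square mult.commute
      del: of_real_power)

lemma norm_herm_le: "cmod (herm u v) \<le> norm u * norm v"
proof -
  have "cmod (herm u v) \<le> (\<Sum>x\<in>UNIV. \<bar>norm (u $ x)\<bar> * \<bar>norm (v $ x)\<bar>)"
    unfolding herm_def by (rule order.trans[OF norm_sum]) (simp add: norm_mult)
  also have "\<dots> \<le> norm u * norm v"
    unfolding norm_vec_def by (rule L2_set_mult_ineq)
  finally show ?thesis .
qed

lemma herm_linear:
  "herm u (v + w) = herm u v + herm u w" "herm u (c *s v) = c * herm u v"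
  "herm u (- v) = - herm u v"
  by (simp_all add: herm_def sum.distrib sum_distrib_left algebra_simps sum_negf)

section \<open>Adjoints\<close>

definition dagger :: "complex^'m^'m \<Rightarrow> complex^'m^'m" where
  "dagger A = (\<chi> x y. cnj (A $ y $ x))"

lemma herm_dagger: "herm (A *v u) v = herm u (dagger A *v v)"
proof -
  have "herm (A *v u) v = (\<Sum>x\<in>UNIV. \<Sum>y\<in>UNIV. cnj (A $ x $ y) * cnj (u $ y) * v $ x)"
    by (simp add: herm_def matrix_vector_mult_def sum_distrib_right)
  also have "\<dots> = (\<Sum>y\<in>UNIV. \<Sum>x\<in>UNIV. cnj (A $ x $ y) * cnj (u $ y) * v $ x)"
    by (rule sum.swap)
  also have "\<dots> = herm u (dagger A *v v)"
    by (simp add: herm_def dagger_def matrix_vector_mult_def sum_distrib_left algebra_simps)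
  finally show ?thesis .
qed

lemma dagger_tensor_op: "dagger (tensor_op A) = tensor_op (\<lambda>i. dagger (A i))"
  by (simp add: dagger_def tensor_op_def vec_eq_iff)

lemma dagger_scale_op: "dagger (scale_op c A) = scale_op (cnj c) (dagger A)"
  by (simp add: dagger_def scale_op_def vec_eq_iff)

lemma dagger_mat_1: "dagger (mat 1) = mat 1"
  by (simp add: dagger_def mat_def vec_eq_iff)

lemma dagger_local_op: "dagger (local_op i M) = local_op i (dagger M)"
  unfolding local_op_def dagger_tensor_op
  by (rule arg_cong[of _ _ tensor_op]) (auto simp: dagger_mat_1)


section \<open>Pauli operators\<close>

text \<open>The commutation sign: two distinct non-identity Pauli matrices anticommute, all other
  pairs commute.\<close>

definition pauli_sign :: "pauli \<Rightarrow> pauli \<Rightarrow> complex" where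
  "pauli_sign a b = (if a = PI \<or> b = PI \<or> a = b then 1 else - 1)"

lemma pauli_sign_PI [simp]: "pauli_sign PI b = 1" "pauli_sign a PI = 1"
  by (simp_all add: pauli_sign_def)

lemma pauli_mat_swap:
  "pauli_mat a ** pauli_mat b = scale_op (pauli_sign a b) (pauli_mat b ** pauli_mat a)"
  by (cases a; cases b)
    (simp_all add: pauli_sign_def scale_op_def matrix_matrix_mult_def vec_eq_iff forall_2 sum_2
      vector_2 mat_def)

lemma pauli_mat_square: "pauli_mat a ** pauli_mat a = mat 1"
  by (cases a) (simp_all add: matrix_matrix_mult_def vec_eq_iff forall_2 sum_2 vector_2 mat_def)

lemma dagger_pauli_mat: "dagger (pauli_mat a) = pauli_mat a"
  by (cases a) (simp_all add: dagger_def vec_eq_iff forall_2 vector_2 mat_def)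

lemma pauli_op_mult:
  "pauli_op c p ** pauli_op e q
    = scale_op (c * e) (tensor_op (\<lambda>i. pauli_mat (p i) ** pauli_mat (q i)))"
  by (simp add: pauli_op_def scale_op_mult tensor_op_mult mult.commute)

lemma pauli_op_swap:
  "pauli_op c p ** pauli_op e q
    = scale_op (\<Prod>i\<in>UNIV. pauli_sign (p i) (q i)) (pauli_op e q ** pauli_op c p)"
  unfolding pauli_op_mult
  by (subst pauli_mat_swap) (simp add: tensor_op_scale algebra_simps)

text \<open>Interchanging the operators costs a sign 1 or -1 on each qubit, and the product of these
  signs is again 1 or -1.\<close>

lemma pauli_op_commute_or_anticommute:
  "pauli_op c p ** pauli_op e q = pauli_op e q ** pauli_op c p \<or>
   pauli_op c p ** pauli_op e q = - (pauli_op e q ** pauli_op c p)"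
proof -
  have "(\<Prod>i\<in>A. pauli_sign (p i) (q i)) \<in> {1, - 1}" for A
    by (induction A rule: infinite_finite_induct) (auto simp: pauli_sign_def)
  from this[of UNIV] show ?thesis
    using pauli_op_swap[of c p e q] by auto
qed

lemma pauli_op_square: "pauli_op c p ** pauli_op c p = scale_op (c * c) (mat 1)"
  by (simp add: pauli_op_mult pauli_mat_square tensor_op_mat_1)

lemma phases_simps: "c \<in> phases \<Longrightarrow> c * cnj c = 1" "c \<in> phases \<Longrightarrow> c \<noteq> 0"
  "c \<in> phases \<Longrightarrow> c * c = 1 \<or> c * c = - 1" "1 \<in> phases"
  by (auto simp: phases_def)

text \<open>Pauli matrices are Hermitian and square to the identity, and a phase has modulus one, so
  the adjoint is a left inverse.\<close>

lemma pauli_op_isometry: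
  assumes "c \<in> phases"
  shows "herm (pauli_op c p *v u) (pauli_op c p *v v) = herm u v"
proof -
  have "dagger (pauli_op c p) ** pauli_op c p = mat 1"
    using assms
    by (simp add: pauli_op_def dagger_scale_op dagger_tensor_op dagger_pauli_mat scale_op_mult
        tensor_op_mult pauli_mat_square tensor_op_mat_1 phases_simps mult.commute)
  then show ?thesis
    by (simp add: herm_dagger matrix_vector_mul_assoc)
qed

text \<open>Let the operator A fix \<psi> and let E fail to commute with A. Then E anticommutes with
  A. Inserting A next to \<psi>, moving it past E and cancelling it by isometry shows that the
  expectation of E equals its own negative.\<close>

lemma expectation_zero_if_not_commute:
  assumes "c \<in> phases" "pauli_op c p *v \<psi> = \<psi>"
    and "pauli_op e q ** pauli_op c p \<noteq> pauli_op c p ** pauli_op e q"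
  shows "herm \<psi> (pauli_op e q *v \<psi>) = 0"
proof -
  define A where "A = pauli_op c p"
  define E where "E = pauli_op e q"
  have anti: "E ** A = - (A ** E)"
    using pauli_op_commute_or_anticommute[of e q c p] assms(3) unfolding A_def E_def by blast
  have "herm \<psi> (E *v \<psi>) = herm \<psi> ((E ** A) *v \<psi>)"
    using assms(2) by (simp add: A_def flip: matrix_vector_mul_assoc)
  also have "\<dots> = - herm \<psi> (A *v (E *v \<psi>))"
    by (simp add: anti matrix_vector_mul_assoc flip: herm_linear(3))
       (simp add: herm_def matrix_vector_mult_def sum_negf)
  also have "\<dots> = - herm (A *v \<psi>) (A *v (E *v \<psi>))"
    using assms(2) by (simp add: A_def)
  also have "\<dots> = - herm \<psi> (E *v \<psi>)"
    using pauli_op_isometry[OF assms(1)] by (simp add: A_def)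
  finally show ?thesis by (simp add: E_def)
qed

section \<open>Pauli operators on a single qubit\<close>

definition single_pauli :: "'n \<Rightarrow> pauli \<Rightarrow> 'n \<Rightarrow> pauli" where
  "single_pauli i a = (\<lambda>_. PI)(i := a)"

lemma pauli_op_single: "pauli_op c (single_pauli i a) = scale_op c (local_op i (pauli_mat a))"
  unfolding pauli_op_def local_op_def single_pauli_def
  by (rule arg_cong[of _ _ "\<lambda>A. scale_op c (tensor_op A)"]) auto

lemma pauli_weight_single: "pauli_weight (single_pauli i a) \<le> 1"
proof -
  have "{j. single_pauli i a j \<noteq> PI} \<subseteq> {i}" by (auto simp: single_pauli_def)
  from card_mono[OF _ this] show ?thesis by (simp add: pauli_weight_def)
qed

text \<open>Away from qubit \<open>i\<close> one factor is always the identity, so only that qubit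
  contributes a sign. Single-qubit Paulis can therefore probe \<open>p\<close> at
  \<open>i\<close>.\<close>

lemma pauli_op_single_swap:
  "pauli_op e (single_pauli i a) ** pauli_op c p
    = scale_op (pauli_sign a (p i)) (pauli_op c p ** pauli_op e (single_pauli i a))"
proof -
  have "(\<Prod>j\<in>UNIV - {i}. pauli_sign (single_pauli i a j) (p j)) = 1"
    by (rule prod.neutral) (auto simp: single_pauli_def)
  then have "(\<Prod>j\<in>UNIV. pauli_sign (single_pauli i a j) (p j)) = pauli_sign a (p i)"
    by (simp add: prod.remove[of UNIV i] single_pauli_def)
  then show ?thesis by (subst pauli_op_swap) simp
qed

text \<open>If the operators were one operator U, interchanging it with the Pauli E given by
  \<open>a\<close> on qubit \<open>i\<close> would produce both signs, so U E = 0. But U and E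
  square to nonzero multiples of the identity.\<close>

lemma pauli_op_neq_if_sign_neq:
  assumes "c \<noteq> 0" "pauli_sign a (p i) \<noteq> pauli_sign a (q i)"
  shows "pauli_op c p \<noteq> pauli_op e q"
proof
  define E where "E = pauli_op 1 (single_pauli i a)"
  define U where "U = pauli_op c p"
  assume "pauli_op c p = pauli_op e q"
  then have "scale_op (pauli_sign a (p i)) (U ** E) = scale_op (pauli_sign a (q i)) (U ** E)"
    using pauli_op_single_swap[of 1 i a c p] pauli_op_single_swap[of 1 i a e q]
    by (simp add: E_def U_def)
  with assms(2) have UE: "U ** E = 0"
    by (auto simp: scale_op_def vec_eq_iff)
  have "scale_op (c * c) (mat 1) = U ** (U ** E) ** E"
    using pauli_op_square[of c p] pauli_op_square[of 1 "single_pauli i a"]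
    by (simp add: U_def E_def matrix_mul_assoc[symmetric] scale_op_mult)
  also have "\<dots> = 0" unfolding UE by (simp add: matrix_matrix_mult_def vec_eq_iff)
  finally show False
    using assms(1) by (auto simp: scale_op_def vec_eq_iff mat_def split: if_splits)
qed


section \<open>Counting stabilizers\<close>

lemma stabilizer_op_cases:
  assumes "stabilizer_group S" "A \<in> S"
  obtains c p where "c \<in> phases" "A = pauli_op c p"
proof -
  have "A \<in> carrier pauli_group"
    using assms by (auto simp: stabilizer_group_def dest: subgroup.mem_carrier)
  then show thesis by (auto simp: pauli_group_def intro: that)
qed

lemma stabilizer_mult_closed:
  assumes "stabilizer_group S" "A \<in> S" "B \<in> S"
  shows "A ** B \<in> S"
  using assms by (auto simp: stabilizer_group_def pauli_group_def dest: subgroup.m_closed)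

lemma stabilizer_one_closed:
  assumes "stabilizer_group S"
  shows "mat 1 \<in> S"
  using assms by (auto simp: stabilizer_group_def pauli_group_def dest: subgroup.one_closed)

text \<open>A Pauli operator with a phase from \<open>phases\<close> squares to plus or minus the
  identity, and the square stays in \<open>S\<close>, which excludes the negative sign.\<close>

lemma stabilizer_square:
  assumes "stabilizer_group S" "A \<in> S"
  shows "A ** A = mat 1"
proof -
  obtain c p where A: "c \<in> phases" "A = pauli_op c p"
    using stabilizer_op_cases[OF assms] .
  have "- mat 1 \<notin> S" using assms by (simp add: stabilizer_group_def)
  then have "c * c \<noteq> - 1"
    using stabilizer_mult_closed[OF assms assms(2)] A pauli_op_square[of c p] by auto
  then show ?thesis
    using A phases_simps(3)[of c] by (auto simp: pauli_op_square)
qed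

text \<open>The generators commute and are involutions, so adding one of them at most doubles the
  set of products formed so far.\<close>

lemma card_stabilizer_le:
  fixes S :: "('n::finite qop) set"
  assumes S: "stabilizer_group S" and G: "independent_generators G S"
  shows "finite S \<and> card S \<le> 2 ^ card G"
proof -
  have gen: "finite G" "generate pauli_group G = S"
    using G by (auto simp: independent_generators_def)
  have GS: "G \<subseteq> S" unfolding gen(2)[symmetric] by (rule subsetI) (rule generate.incl)
  have comm: "A ** B = B ** A" if "A \<in> S" "B \<in> S" for A B
    using S that by (auto simp: stabilizer_group_def)
  have sq: "A ** A = mat 1" if "A \<in> S" for A
    using stabilizer_square[OF S that] .
  \<comment> \<open>\<open>T\<close> stands in for the subgroup generated by \<open>H\<close>:
    starting from the identity, closure under left multiplication by \<open>H\<close> captures every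
    product of elements of \<open>H\<close>.\<close>
  have "\<exists>T. finite T \<and> card T \<le> 2 ^ card H \<and> mat 1 \<in> T \<and> (\<forall>h\<in>H. \<forall>t\<in>T. h ** t \<in> T)"
    if "H \<subseteq> G" for H
    using finite_subset[OF that gen(1)] that
  proof (induction H rule: finite_induct)
    case empty
    show ?case by (intro exI[of _ "{mat 1}"]) simp
  next
    case (insert g H)
    then obtain T where T: "finite T" "card T \<le> 2 ^ card H" "mat 1 \<in> T"
      "\<And>h t. h \<in> H \<Longrightarrow> t \<in> T \<Longrightarrow> h ** t \<in> T"
      using insert.IH insert.prems by blast
    \<comment> \<open>The new generator adds the translate of \<open>T\<close> by \<open>g\<close>.
      Since \<open>g\<close> is an involution it swaps the two halves, and an earlier generator
      preserves each half because it commutes with \<open>g\<close>.\<close>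
    define T' where "T' = T \<union> (\<lambda>t. g ** t) ` T"
    have gS: "g \<in> S" and HS: "H \<subseteq> S" using insert.prems GS by auto
    have "card T' \<le> card T + card T"
      unfolding T'_def using T(1)
      by (intro order.trans[OF card_Un_le] add_mono card_image_le) auto
    then have "card T' \<le> 2 ^ card (insert g H)"
      using T(2) insert.hyps by simp
    moreover have "g ** t \<in> T'" if "t \<in> T'" for t
    proof -
      have "g ** (g ** t') = t'" for t' :: "'n qop"
        by (simp add: matrix_mul_assoc sq[OF gS])
      then show ?thesis using that by (auto simp: T'_def)
    qed
    moreover have "h ** t \<in> T'" if h: "h \<in> H" and t: "t \<in> T'" for h t
    proof -
      have hT: "h ** t' \<in> T" if "t' \<in> T" for t' using T(4)[OF h that] .
      consider "t \<in> T" | t' where "t' \<in> T" "t = g ** t'"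
        using t unfolding T'_def by (elim UnE imageE)
      then show ?thesis
      proof cases
        case 1
        then show ?thesis using hT by (simp add: T'_def)
      next
        case 2
        have "h ** g = g ** h" using comm gS HS h by blast
        then have "h ** t = g ** (h ** t')" by (simp only: 2 matrix_mul_assoc)
        then show ?thesis using hT[OF 2(1)] by (simp add: T'_def)
      qed
    qed
    moreover have "finite T'" "mat 1 \<in> T'" using T(1,3) by (auto simp: T'_def)
    ultimately show ?case by (intro exI[of _ T']) simp
  qed
  from this[OF subset_refl] obtain T where T: "finite T" "card T \<le> 2 ^ card G" "mat 1 \<in> T"
    "\<And>h t. h \<in> G \<Longrightarrow> t \<in> T \<Longrightarrow> h ** t \<in> T"
    by blast
  \<comment> \<open>This handles the inverse case of \<open>generate\<close>: generators are their
    own inverses.\<close>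
  have inv_eq: "inv\<^bsub>pauli_group\<^esub> h = h" if "h \<in> G" for h
  proof -
    have h: "h \<in> carrier pauli_group" "h ** h = mat 1"
      using that G GS sq by (auto simp: independent_generators_def)
    show ?thesis
      unfolding m_inv_def
    proof (rule the_equality)
      fix y assume "y \<in> carrier pauli_group \<and> h \<otimes>\<^bsub>pauli_group\<^esub> y = \<one>\<^bsub>pauli_group\<^esub> \<and>
        y \<otimes>\<^bsub>pauli_group\<^esub> h = \<one>\<^bsub>pauli_group\<^esub>"
      then have "h ** y = mat 1" by (simp add: pauli_group_def)
      then have "h ** (h ** y) = h" by simp
      then show "y = h" by (simp add: matrix_mul_assoc h)
    qed (use h in \<open>auto simp: pauli_group_def\<close>)
  qed
  \<comment> \<open>Left multiplication preserving all of \<open>T\<close> composes, unlike mere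
    membership of \<open>h\<close> in \<open>T\<close>; applied to the identity it gives
    \<open>S \<subseteq> T\<close>.\<close>
  have "\<forall>t\<in>T. h ** t \<in> T" if "h \<in> generate pauli_group G" for h
    using that
  proof (induction rule: generate.induct)
    case one
    then show ?case by (simp add: pauli_group_def)
  next
    case (incl h)
    then show ?case using T(4) by blast
  next
    case (inv h)
    then show ?case using T(4) inv_eq by simp
  next
    case (eng h1 h2)
    then show ?case by (auto simp: pauli_group_def matrix_mul_assoc[symmetric])
  qed
  then have "S \<subseteq> T" using gen(2) T(3) by force
  then show ?thesis
    using T card_mono[of T S] finite_subset by fastforce
qed

lemma exists_qubit_without_local_stabilizer:
  fixes S :: "('n::finite qop) set"
  assumes S: "stabilizer_group S" and G: "independent_generators G S"
    and less: "card G < CARD('n)"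
  shows "\<exists>i. \<forall>a c. a \<noteq> PI \<longrightarrow> c \<in> phases \<longrightarrow> pauli_op c (single_pauli i a) \<notin> S"
proof (rule ccontr)
  assume "\<not> ?thesis"
  then obtain a where a: "\<And>i. a i \<noteq> PI" "\<And>i. \<exists>c\<in>phases. pauli_op c (single_pauli i (a i)) \<in> S"
    by metis
  \<comment> \<open>The Pauli string of the product of the chosen weight-one stabilizers over the
    qubits in \<open>A\<close>. Its accumulated phase is tracked below only as a nonzero scalar,
    enough to tell the operators apart.\<close>
  define q where "q A = (\<lambda>i. if i \<in> A then a i else PI)" for A
  have "\<exists>c. c \<noteq> 0 \<and> pauli_op c (q A) \<in> S" for A :: "'n set"
  proof (induction A rule: infinite_finite_induct)
    case empty
    have "pauli_op 1 (q {}) \<in> S"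
      using stabilizer_one_closed[OF S] by (simp add: q_def pauli_op_def tensor_op_mat_1)
    then show ?case by (metis zero_neq_one)
  next
    case (insert j A)
    then obtain c where c: "c \<noteq> 0" "pauli_op c (q A) \<in> S" by blast
    obtain e where e: "e \<in> phases" "pauli_op e (single_pauli j (a j)) \<in> S" using a by blast
    have "pauli_op c (q A) ** pauli_op e (single_pauli j (a j)) = pauli_op (c * e) (q (insert j A))"
      unfolding pauli_op_mult unfolding pauli_op_def
      by (rule arg_cong[of _ _ "\<lambda>B. scale_op (c * e) (tensor_op B)"])
        (use insert in \<open>auto simp: q_def single_pauli_def\<close>)
    then have "pauli_op (c * e) (q (insert j A)) \<in> S"
      using stabilizer_mult_closed[OF S c(2) e(2)] by simp
    then show ?case using c e phases_simps(2)[of e] by (metis no_zero_divisors)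
  qed simp
  then obtain c where c: "\<And>A. c A \<noteq> 0" "\<And>A. pauli_op (c A) (q A) \<in> S" by metis
  have neq: "pauli_op (c A) (q A) \<noteq> pauli_op (c B) (q B)" if "j \<in> A" "j \<notin> B" for A B j
  proof -
    \<comment> \<open>A non-identity Pauli different from \<open>a j\<close>: it anticommutes with
      the entry of \<open>q A\<close> at \<open>j\<close> but commutes with that of
      \<open>q B\<close>, which is the identity.\<close>
    define b where "b = (if a j = PX then PZ else PX)"
    have "pauli_sign b (a j) = - 1"
      using a(1)[of j] by (simp add: pauli_sign_def b_def)
    then show ?thesis
      using that c(1) by (intro pauli_op_neq_if_sign_neq[of _ b _ j]) (auto simp: q_def)
  qed
  have "inj (\<lambda>A. pauli_op (c A) (q A))"
    by (rule injI) (metis neq subsetI subset_antisym)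
  then have "card (UNIV :: 'n set set) \<le> card S"
    using c(2) card_stabilizer_le[OF S G] by (intro card_inj_on_le) auto
  also have "card S \<le> 2 ^ card G"
    using card_stabilizer_le[OF S G] by simp
  also have "\<dots> < 2 ^ CARD('n)"
    using less by simp
  finally show False using card_Pow[of "UNIV :: 'n set"] by simp
qed


section \<open>Codewords with a maximally mixed qubit\<close>

text \<open>The Pauli matrices are a basis, and each coefficient is half the trace of
  \<open>M\<close> times the basis matrix. Only the coefficient of the identity is named, because
  the other three terms will have expectation zero.\<close>

lemma pauli_decomposition:
  fixes M :: "complex^2^2"
  obtains x y z where "M = scale_op ((M$1$1 + M$2$2) / 2) (mat 1) +
    scale_op x (pauli_mat PX) + scale_op y (pauli_mat PY) + scale_op z (pauli_mat PZ)"
proof (rule that)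
  show "M = scale_op ((M$1$1 + M$2$2) / 2) (mat 1) +
    scale_op ((M$1$2 + M$2$1) / 2) (pauli_mat PX) +
    scale_op (\<i> * (M$1$2 - M$2$1) / 2) (pauli_mat PY) +
    scale_op ((M$1$1 - M$2$2) / 2) (pauli_mat PZ)"
    by (simp add: scale_op_def vec_eq_iff forall_2 vector_2 mat_def) (auto simp: field_simps)
qed

text \<open>By linearity in \<open>M\<close> only the identity component survives: the reduced state
  of qubit \<open>i\<close> is a multiple of the identity.\<close>

lemma local_expectation_maximally_mixed:
  assumes "\<And>a. a \<noteq> PI \<Longrightarrow> herm \<psi> (local_op i (pauli_mat a) *v \<psi>) = 0"
  shows "herm \<psi> (local_op i M *v \<psi>) = (M$1$1 + M$2$2) / 2 * herm \<psi> \<psi>"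
proof -
  obtain x y z where M: "M = scale_op ((M$1$1 + M$2$2) / 2) (mat 1) +
    scale_op x (pauli_mat PX) + scale_op y (pauli_mat PY) + scale_op z (pauli_mat PZ)"
    by (rule pauli_decomposition)
  show ?thesis
    unfolding arg_cong[OF M, of "local_op i", unfolded local_op_add local_op_scale local_op_mat_1]
    using assms[of PX] assms[of PY] assms[of PZ]
    by (simp add: matrix_vector_mult_add_rdistrib scale_op_vec herm_linear
        del: pauli_mat.simps)
qed

text \<open>Let P be r times the orthogonal projection of qubit \<open>i\<close> onto the line of
  \<open>\<phi> i\<close>, where r is the squared norm of \<open>\<phi> i\<close>. The product
  vector is an eigenvector of P with eigenvalue r, while maximal mixing gives P \<psi> the norm of
  \<psi> times r times \<open>sqrt (1 / 2)\<close>. Moving P across the form and applying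
  Cauchy-Schwarz gives the bound.\<close>

lemma overlap_product_le:
  assumes mixed: "\<And>a. a \<noteq> PI \<Longrightarrow> herm \<psi> (local_op i (pauli_mat a) *v \<psi>) = 0"
    and \<phi>: "\<phi> i \<noteq> 0"
  shows "cmod (herm \<psi> (tensor_vec \<phi>)) \<le> sqrt (1 / 2) * (norm \<psi> * norm (tensor_vec \<phi>))"
proof -
  define r where "r = (norm (\<phi> i))\<^sup>2"
  have r: "r > 0" using \<phi> by (simp add: r_def)
  \<comment> \<open>The unnormalised rank-one projector onto \<open>\<phi> i\<close>; leaving out
    the normalisation puts a factor \<open>r\<close> into its trace, its square and its
    eigenvalue.\<close>
  define M :: "complex^2^2" where "M = (\<chi> x y. \<phi> i $ x * cnj (\<phi> i $ y))"
  have r_herm: "complex_of_real r = herm (\<phi> i) (\<phi> i)"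
    by (simp add: r_def herm_self)
  have tr: "M$1$1 + M$2$2 = r"
    by (simp add: r_herm herm_def M_def sum_2 mult.commute)
  have MM: "M ** M = scale_op r M"
    unfolding r_herm
    by (simp add: M_def herm_def matrix_matrix_mult_def scale_op_def vec_eq_iff sum_2 algebra_simps)
  have M\<phi>: "M *v \<phi> i = complex_of_real r *s \<phi> i"
    unfolding r_herm
    by (simp add: M_def herm_def matrix_vector_mult_def vec_eq_iff sum_2 algebra_simps)
  have dag: "dagger M = M"
    by (simp add: dagger_def M_def vec_eq_iff)
  define P where "P = local_op i M"
  have dagP: "dagger P = P" by (simp add: P_def dagger_local_op dag)
  have "herm (P *v \<psi>) (P *v \<psi>) = herm \<psi> ((P ** P) *v \<psi>)"
    by (simp add: herm_dagger dagP matrix_vector_mul_assoc)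
  also have "\<dots> = r * herm \<psi> (P *v \<psi>)"
    by (simp add: P_def local_op_mult MM local_op_scale scale_op_vec herm_linear)
  also have "herm \<psi> (P *v \<psi>) = (M$1$1 + M$2$2) / 2 * herm \<psi> \<psi>"
    unfolding P_def using mixed by (rule local_expectation_maximally_mixed)
  also have "r * \<dots> = of_real (r\<^sup>2 / 2 * (norm \<psi>)\<^sup>2)"
    unfolding tr
    by (simp add: herm_self power2_eq_square)
  finally have "(norm (P *v \<psi>))\<^sup>2 = r\<^sup>2 / 2 * (norm \<psi>)\<^sup>2"
    unfolding herm_self of_real_eq_iff .
  then have "norm (P *v \<psi>) = sqrt (r\<^sup>2 / 2 * (norm \<psi>)\<^sup>2)"
    by (metis norm_ge_zero real_sqrt_unique)
  then have P: "norm (P *v \<psi>) = r * (sqrt (1 / 2) * norm \<psi>)"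
    using r by (simp add: real_sqrt_mult real_sqrt_divide)
  have "r * cmod (herm \<psi> (tensor_vec \<phi>)) = cmod (herm \<psi> (P *v tensor_vec \<phi>))"
    using r by (simp add: P_def local_op_tensor_vec[of M \<phi> i, OF M\<phi>] herm_linear norm_mult)
  also have "\<dots> = cmod (herm (P *v \<psi>) (tensor_vec \<phi>))"
    by (simp add: herm_dagger dagP)
  also have "\<dots> \<le> norm (P *v \<psi>) * norm (tensor_vec \<phi>)"
    by (rule norm_herm_le)
  also have "\<dots> = r * (sqrt (1 / 2) * (norm \<psi> * norm (tensor_vec \<phi>)))"
    by (simp only: P mult.assoc)
  finally show ?thesis using r by (simp only: mult_le_cancel_left_pos)
qed

lemma code_distance_le:
  assumes "c \<in> phases" "pauli_op c p \<in> logical_ops S"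
  shows "code_distance S \<le> pauli_weight p"
  unfolding code_distance_def using assms by (intro Least_le) blast

text \<open>An operator of weight at most one is below the distance, hence not logical. As no phase
  multiple of it lies in \<open>S\<close>, the only way to fail being logical is not to commute with
  some stabilizer, and then its expectation vanishes.\<close>

lemma codeword_maximally_mixed:
  assumes S: "stabilizer_group S" and d: "code_distance S \<ge> 2" and \<psi>: "\<psi> \<in> code_space S"
    and i: "\<And>c. c \<in> phases \<Longrightarrow> pauli_op c (single_pauli i a) \<notin> S"
  shows "herm \<psi> (local_op i (pauli_mat a) *v \<psi>) = 0"
proof -
  define E where "E = pauli_op 1 (single_pauli i a)"
  have E: "E = local_op i (pauli_mat a)" by (simp add: E_def pauli_op_single)
  have "E \<notin> logical_ops S"
    using code_distance_le[of 1 "single_pauli i a" S] pauli_weight_single[of i a] d phases_simps(4)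
    by (auto simp: E_def)
  moreover have "E \<in> carrier pauli_group"
    using phases_simps(4) by (auto simp: E_def pauli_group_def)
  moreover have "scale_op c E \<notin> S" if "c \<in> phases" for c
    using i[OF that] by (simp add: E pauli_op_single)
  ultimately obtain A where A: "A \<in> S" "E ** A \<noteq> A ** E"
    by (auto simp: logical_ops_def)
  obtain c p where cp: "c \<in> phases" "A = pauli_op c p"
    using stabilizer_op_cases[OF S A(1)] .
  have "A *v \<psi> = \<psi>" using \<psi> A(1) by (simp add: code_space_def)
  then have "herm \<psi> (E *v \<psi>) = 0"
    using expectation_zero_if_not_commute[of c p \<psi>] cp A(2) unfolding E_def by blast
  then show ?thesis by (simp add: E)
qed


section \<open>Geometric entanglement\<close>

text \<open>Choosing a nonzero representative of each projective factor passes from the quotient to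
  actual product vectors.\<close>

lemma segre_variety_cases:
  fixes \<Phi> :: "('n::finite \<Rightarrow> 2) cproj"
  assumes "\<Phi> \<in> segre_variety"
  obtains \<phi> where "\<And>i. \<phi> i \<noteq> 0" "\<Phi> = proj_class (tensor_vec \<phi>)"
proof -
  obtain P where P: "\<Phi> = segre P" using assms by (auto simp: segre_variety_def)
  have "\<exists>v. v \<noteq> 0 \<and> P i = proj_class v" for i
    using Quotient_abs_rep[OF Quotient_cproj, of "P i"]
      Quotient_rep_reflp[OF Quotient_cproj, of "P i"]
    unfolding same_ray_def by metis
  then obtain f where f: "\<And>i. f i \<noteq> 0" "\<And>i. P i = proj_class (f i)" by metis
  have "P = (\<lambda>i. proj_class (f i))" using f by auto
  moreover have "same_ray (f i) (f i)" for i
    using f(1)[of i] by (auto simp: same_ray_def intro!: exI[of _ 1])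
  ultimately have "\<Phi> = proj_class (tensor_vec f)"
    using segre.abs_eq[of f] P by (simp add: eq_onp_def rel_fun_def comp_def map_fun_def)
  with f(1) show thesis by (rule that)
qed

lemma fs_dist_proj_class:
  assumes "\<psi> \<noteq> 0" "\<phi> \<noteq> 0"
  shows "fs_dist (proj_class \<psi>) (proj_class \<phi>)
    = arccos (cmod (herm \<psi> \<phi>) / (norm \<psi> * norm \<phi>))"
proof -
  have "same_ray \<psi> \<psi>" "same_ray \<phi> \<phi>"
    using assms by (auto simp: same_ray_def intro!: exI[of _ 1])
  then show ?thesis by (rule fs_dist.abs_eq)
qed

text \<open>The infimum is attained at some product state, so one overlap has to be bounded;
  \<open>arccos\<close> is decreasing, so an upper bound on it becomes a lower bound on the
  distance.\<close>

lemma geometric_entanglement_ge: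
  assumes \<psi>: "\<psi> \<noteq> 0" and "t \<le> 1"
    and overlap: "\<And>\<phi>. (\<And>i. \<phi> i \<noteq> 0) \<Longrightarrow>
      cmod (herm \<psi> (tensor_vec \<phi>)) \<le> t * (norm \<psi> * norm (tensor_vec \<phi>))"
  shows "geometric_entanglement (proj_class \<psi>) \<ge> arccos t"
proof -
  obtain \<Phi> where \<Phi>: "\<Phi> \<in> segre_variety"
    "geometric_entanglement (proj_class \<psi>) = fs_dist (proj_class \<psi>) \<Phi>"
    using geometric_entanglement_attained by blast
  obtain \<phi> where \<phi>: "\<And>i. \<phi> i \<noteq> 0" "\<Phi> = proj_class (tensor_vec \<phi>)"
    using segre_variety_cases[OF \<Phi>(1)] by metis
  have nz: "tensor_vec \<phi> \<noteq> 0" using \<phi>(1) by (rule tensor_vec_nonzero)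
  define q where "q = cmod (herm \<psi> (tensor_vec \<phi>)) / (norm \<psi> * norm (tensor_vec \<phi>))"
  \<comment> \<open>Nonnegativity keeps \<open>q\<close> in the domain [-1, 1] on which
    \<open>arccos\<close> is monotone.\<close>
  have "q \<ge> 0" by (simp add: q_def)
  moreover have "q \<le> t"
    using overlap[OF \<phi>(1)] \<psi> nz by (simp add: q_def pos_divide_le_eq)
  ultimately have "arccos t \<le> arccos q"
    using \<open>t \<le> 1\<close> by (intro arccos_le_arccos) auto
  then show ?thesis using fs_dist_proj_class[OF \<psi> nz] \<Phi> \<phi> by (simp add: q_def)
qed

theorem mainTheorem5:
  fixes S :: "('n::finite qop) set" and k d :: nat and \<psi> :: "'n qstate"
  assumes "stabilizer_code S k d"
    and "k \<ge> 1" and "d \<ge> 2"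
    and "\<psi> \<in> code_space S" and "\<psi> \<noteq> 0"
  shows "geometric_entanglement (proj_class \<psi>) > 0 \<and>
    geometric_entanglement (proj_class \<psi>) \<ge> arccos (sqrt (1 - 1 / 2 ^ (d div 2)))"
proof -
  obtain G where S: "stabilizer_group S" and G: "independent_generators G S"
    and card: "card G + k = CARD('n)" and d: "code_distance S = d"
    using assms(1) by (auto simp: stabilizer_code_def)
  have "card G < CARD('n)" using card \<open>k \<ge> 1\<close> by linarith
  from exists_qubit_without_local_stabilizer[OF S G this]
  obtain i where i: "\<And>a c. a \<noteq> PI \<Longrightarrow> c \<in> phases \<Longrightarrow> pauli_op c (single_pauli i a) \<notin> S"
    by blast
  have mixed: "herm \<psi> (local_op i (pauli_mat a) *v \<psi>) = 0" if "a \<noteq> PI" for a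
    using codeword_maximally_mixed[OF S _ assms(4), of i a] i[OF that] d \<open>d \<ge> 2\<close> by blast
  have ge: "geometric_entanglement (proj_class \<psi>) \<ge> arccos (sqrt (1 / 2))"
    using \<open>\<psi> \<noteq> 0\<close> by (intro geometric_entanglement_ge overlap_product_le[where i = i] mixed) auto
  have "arccos 1 < arccos (sqrt (1 / 2))"
    by (intro arccos_less_arccos) (auto intro: order.trans[of _ 0])
  then have pos: "arccos (sqrt (1 / 2)) > 0" by simp
  \<comment> \<open>The claimed bound decreases as \<open>d div 2\<close> grows, so its largest
    value is at exponent 1, where it equals the bound already obtained.\<close>
  have "(2::real) ^ 1 \<le> 2 ^ (d div 2)"
    using \<open>d \<ge> 2\<close> by (intro power_increasing) auto
  then have "1 / 2 ^ (d div 2) \<le> (1 / 2 :: real)"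
    by (simp add: field_simps)
  then have "sqrt (1 / 2) \<le> sqrt (1 - 1 / 2 ^ (d div 2))" by simp
  moreover have "sqrt (1 - 1 / 2 ^ (d div 2)) \<le> 1" by simp
  moreover have "- 1 \<le> sqrt (1 / 2)" by (rule order.trans[of _ 0]) auto
  ultimately have "arccos (sqrt (1 - 1 / 2 ^ (d div 2))) \<le> arccos (sqrt (1 / 2))"
    by (intro arccos_le_arccos)
  with ge pos show ?thesis by linarith
qed

end
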